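(* If $s\in\mathbb{Q}$, then the complex Lie algebra $s\,\mathcal{U}_2+\mathcal{U}_3$ is Anosov.
   Context: Anosov: a rational Lie algebra $\mathfrak{n}^{\mathbb{Q}}$ of dimension $n$ is Anosov if it admits an automorphism $\tau$ which is hyperbolic (no complex eigenvalue of absolute value $1$) and unimodular, i.e. $[\tau]_\beta\in \mathrm{GL}_n(\mathbb{Z})$ for some basis $\beta$ of $\mathfrak{n}^{\mathbb{Q}}$. A real or complex Lie algebra is Anosov if it has a rational form which is Anosov. For $s\in\mathbb{C}$, $s\,\mathcal{U}_2+\mathcal{U}_3$ denotes the $9$-dimensional $2$-step nilpotent complex Lie algebra with basis $v_1,\dots,v_6,w_1,w_2,w_3$ whose brackets of basis vectors are zero except (up to antisymmetry) for $[v_5,v_4]=s\,w_1$, $[v_1,v_6]=s\,w_2$, $[v_3,v_2]=s\,w_3$, $[v_3,v_6]=w_1$, $[v_5,v_2]=w_2$, $[v_1,v_4]=w_3$. *)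

theory Defs
  imports "HOL-Analysis.Cartesian_Space"
    "Jordan_Normal_Form.Char_Poly"
begin

text \<open>A Lie algebra over a field, carried by a subspace \<open>L\<close> of an ambient vector space. The ambient
  space lets a rational form live inside the complex algebra it spans.\<close>

locale lie_algebra = vector_space scl
  for scl :: "'k::field \<Rightarrow> 'v::ab_group_add \<Rightarrow> 'v" +
  fixes br :: "'v \<Rightarrow> 'v \<Rightarrow> 'v" and L :: "'v set"
  assumes subspace_carrier: "subspace L"
    and br_closed: "x \<in> L \<Longrightarrow> y \<in> L \<Longrightarrow> br x y \<in> L"
    and br_add_left: "x \<in> L \<Longrightarrow> y \<in> L \<Longrightarrow> z \<in> L \<Longrightarrow> br (x + y) z = br x z + br y z"
    and br_add_right: "x \<in> L \<Longrightarrow> y \<in> L \<Longrightarrow> z \<in> L \<Longrightarrow> br x (y + z) = br x y + br x z"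
    and br_scale_left: "x \<in> L \<Longrightarrow> y \<in> L \<Longrightarrow> br (scl c x) y = scl c (br x y)"
    and br_scale_right: "x \<in> L \<Longrightarrow> y \<in> L \<Longrightarrow> br x (scl c y) = scl c (br x y)"
    and br_self: "x \<in> L \<Longrightarrow> br x x = 0"
    and jacobi: "x \<in> L \<Longrightarrow> y \<in> L \<Longrightarrow> z \<in> L \<Longrightarrow>
      br x (br y z) + br y (br z x) + br z (br x y) = 0"

definition lie_automorphism ::
  "('k::field \<Rightarrow> 'v::ab_group_add \<Rightarrow> 'v) \<Rightarrow> ('v \<Rightarrow> 'v \<Rightarrow> 'v) \<Rightarrow> 'v set \<Rightarrow> ('v \<Rightarrow> 'v) \<Rightarrow> bool" where
  "lie_automorphism scl br L \<tau> \<longleftrightarrow>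
     bij_betw \<tau> L L \<and>
     (\<forall>x\<in>L. \<forall>y\<in>L. \<tau> (x + y) = \<tau> x + \<tau> y) \<and>
     (\<forall>c. \<forall>x\<in>L. \<tau> (scl c x) = scl c (\<tau> x)) \<and>
     (\<forall>x\<in>L. \<forall>y\<in>L. \<tau> (br x y) = br (\<tau> x) (\<tau> y))"

definition ordered_basis ::
  "('k::field \<Rightarrow> 'v::ab_group_add \<Rightarrow> 'v) \<Rightarrow> 'v set \<Rightarrow> 'v list \<Rightarrow> bool" where
  "ordered_basis scl L bs \<longleftrightarrow>
     distinct bs \<and> \<not> module.dependent scl (set bs) \<and> module.span scl (set bs) = L"

text \<open>Column \<open>j\<close> holds the coordinates of the image of the \<open>j\<close>-th basis vector.\<close>

definition matrix_wrt ::
  "('k::field \<Rightarrow> 'v::ab_group_add \<Rightarrow> 'v) \<Rightarrow> 'v list \<Rightarrow> ('v \<Rightarrow> 'v) \<Rightarrow> 'k mat" where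
  "matrix_wrt scl bs \<tau> =
     mat (length bs) (length bs)
       (\<lambda>(i, j). module.representation scl (set bs) (\<tau> (bs ! j)) (bs ! i))"

text \<open>The choice of basis is immaterial: two bases give similar matrices.\<close>

definition complex_eigenvalue ::
  "(rat \<Rightarrow> 'v::ab_group_add \<Rightarrow> 'v) \<Rightarrow> 'v set \<Rightarrow> ('v \<Rightarrow> 'v) \<Rightarrow> complex \<Rightarrow> bool" where
  "complex_eigenvalue scl L \<tau> c \<longleftrightarrow>
     (\<exists>bs. ordered_basis scl L bs \<and> eigenvalue (map_mat of_rat (matrix_wrt scl bs \<tau>)) c)"

definition hyperbolic ::
  "(rat \<Rightarrow> 'v::ab_group_add \<Rightarrow> 'v) \<Rightarrow> 'v set \<Rightarrow> ('v \<Rightarrow> 'v) \<Rightarrow> bool" where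
  "hyperbolic scl L \<tau> \<longleftrightarrow> (\<forall>c. complex_eigenvalue scl L \<tau> c \<longrightarrow> cmod c \<noteq> 1)"

definition unimodular ::
  "(rat \<Rightarrow> 'v::ab_group_add \<Rightarrow> 'v) \<Rightarrow> 'v set \<Rightarrow> ('v \<Rightarrow> 'v) \<Rightarrow> bool" where
  "unimodular scl L \<tau> \<longleftrightarrow>
     (\<exists>bs. ordered_basis scl L bs \<and>
       (\<exists>A :: int mat. invertible_mat A \<and> matrix_wrt scl bs \<tau> = map_mat of_int A))"

text \<open>Finite dimension is part of \<^const>\<open>unimodular\<close>.\<close>

definition rational_anosov ::
  "(rat \<Rightarrow> 'v::ab_group_add \<Rightarrow> 'v) \<Rightarrow> ('v \<Rightarrow> 'v \<Rightarrow> 'v) \<Rightarrow> 'v set \<Rightarrow> bool" where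
  "rational_anosov scl br L \<longleftrightarrow>
     lie_algebra scl br L \<and>
     (\<exists>\<tau>. lie_automorphism scl br L \<tau> \<and> hyperbolic scl L \<tau> \<and> unimodular scl L \<tau>)"

definition rat_scale :: "('k::field_char_0 \<Rightarrow> 'v \<Rightarrow> 'v) \<Rightarrow> rat \<Rightarrow> 'v \<Rightarrow> 'v" where
  "rat_scale scl q x = scl (of_rat q) x"

text \<open>The last conjunct says that the canonical map from the scalar extension of \<open>Q\<close> to \<open>L\<close>
  is bijective.\<close>

definition rational_form ::
  "('k::field_char_0 \<Rightarrow> 'v::ab_group_add \<Rightarrow> 'v) \<Rightarrow> ('v \<Rightarrow> 'v \<Rightarrow> 'v) \<Rightarrow> 'v set \<Rightarrow> 'v set \<Rightarrow> bool" where
  "rational_form scl br L Q \<longleftrightarrow>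
     lie_algebra (rat_scale scl) br Q \<and>
     (\<exists>B. \<not> module.dependent (rat_scale scl) B \<and> module.span (rat_scale scl) B = Q \<and>
          \<not> module.dependent scl B \<and> module.span scl B = L)"

definition anosov ::
  "('k::field_char_0 \<Rightarrow> 'v::ab_group_add \<Rightarrow> 'v) \<Rightarrow> ('v \<Rightarrow> 'v \<Rightarrow> 'v) \<Rightarrow> 'v set \<Rightarrow> bool" where
  "anosov scl br L \<longleftrightarrow>
     lie_algebra scl br L \<and>
     (\<exists>Q. rational_form scl br L Q \<and> rational_anosov (rat_scale scl) br Q)"

datatype basis_index = V1 | V2 | V3 | V4 | V5 | V6 | W1 | W2 | W3

instance basis_index :: finite
proof
  have "(UNIV :: basis_index set) \<subseteq> {V1, V2, V3, V4, V5, V6, W1, W2, W3}"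
    using basis_index.exhaust by auto
  then show "finite (UNIV :: basis_index set)"
    by (rule finite_subset) simp
qed

text \<open>The listed brackets of basis vectors, in the listed order only; the second definition
  antisymmetrizes and the third extends bilinearly.\<close>

fun U23_table :: "complex \<Rightarrow> basis_index \<Rightarrow> basis_index \<Rightarrow> complex ^ basis_index" where
  "U23_table s V5 V4 = axis W1 s"
| "U23_table s V1 V6 = axis W2 s"
| "U23_table s V3 V2 = axis W3 s"
| "U23_table s V3 V6 = axis W1 1"
| "U23_table s V5 V2 = axis W2 1"
| "U23_table s V1 V4 = axis W3 1"
| "U23_table s _ _ = 0"

definition U23_basis_bracket ::
  "complex \<Rightarrow> basis_index \<Rightarrow> basis_index \<Rightarrow> complex ^ basis_index" where
  "U23_basis_bracket s i j = U23_table s i j - U23_table s j i"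

definition U23_bracket ::
  "complex \<Rightarrow> complex ^ basis_index \<Rightarrow> complex ^ basis_index \<Rightarrow> complex ^ basis_index" where
  "U23_bracket s x y =
     (\<Sum>i\<in>UNIV. \<Sum>j\<in>UNIV. (vec_nth x i * vec_nth y j) *s U23_basis_bracket s i j)"

end

theory Submission imports Defs begin

text \<open>Let \<open>K = \<rat>(\<theta>)\<close> be the cyclic cubic field with \<open>\<theta>\<^sup>3 - 3\<theta> + 1 = 0\<close>, and let \<open>\<sigma>\<close>
  generate its Galois group. The bracket of \<open>s U\<^sub>2 + U\<^sub>3\<close> pairs the span of
  \<open>v\<^sub>1, v\<^sub>3, v\<^sub>5\<close> with the span of \<open>v\<^sub>2, v\<^sub>4, v\<^sub>6\<close> and is equivariant under the cyclic shift of
  indices. For rational \<open>s\<close> the vectors whose coordinates on each of the three blocks are the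
  conjugates \<open>x, \<sigma>x, \<sigma>\<^sup>2x\<close> of an element of \<open>K\<close> therefore form a rational form: on it the bracket
  is \<open>(x, y) \<mapsto> \<sigma>x \<sigma>\<^sup>2y + s \<sigma>\<^sup>2x \<sigma>y\<close>. Multiplication by the unit \<open>\<theta>\<close> on the first two blocks
  induces multiplication by \<open>\<sigma>\<theta> \<sigma>\<^sup>2\<theta> = -1/\<theta>\<close> on the center. This automorphism is integral in the
  basis \<open>1, \<theta>, \<theta>\<^sup>2\<close>, and an eigenvalue \<open>c\<close> satisfies \<open>c\<^sup>3 + 1 = 3c\<close> or \<open>1 - c\<^sup>3 = 3c\<^sup>2\<close>,
  both impossible for \<open>\<bar>c\<bar> = 1\<close> by the triangle inequality.\<close>

section \<open>Restriction of scalars to the rationals, explicit bases and eigenvalues\<close>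

lemma vector_space_rat_scale:
  assumes "vector_space scl"
  shows "vector_space (rat_scale scl)"
proof -
  interpret vector_space scl by fact
  show ?thesis
    by unfold_locales
      (simp_all add: rat_scale_def scale_right_distrib scale_left_distrib of_rat_add of_rat_mult)
qed

lemma lie_algebra_rat_scale:
  assumes "lie_algebra scl br L" "module.subspace (rat_scale scl) Q" "Q \<subseteq> L"
    and "\<And>x y. x \<in> Q \<Longrightarrow> y \<in> Q \<Longrightarrow> br x y \<in> Q"
  shows "lie_algebra (rat_scale scl) br Q"
proof -
  interpret lie_algebra scl br L by fact
  interpret q: vector_space "rat_scale scl"
    by (rule vector_space_rat_scale) unfold_locales
  show ?thesis
    using assms(2-4) br_add_left br_add_right br_self jacobi
    by unfold_locales (auto simp: rat_scale_def subset_iff br_scale_left br_scale_right)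
qed

text \<open>A rational relation is also one over the larger field, with coefficients
  \<open>of_rat\<close>, and \<open>of_rat\<close> is injective.\<close>

lemma independent_rat_scale:
  assumes "vector_space scl" "\<not> module.dependent scl B"
  shows "\<not> module.dependent (rat_scale scl) B"
proof -
  interpret vector_space scl by fact
  interpret q: vector_space "rat_scale scl"
    by (rule vector_space_rat_scale) fact
  show ?thesis
    using assms(2) unfolding dependent_explicit q.dependent_explicit
    by (auto simp: rat_scale_def) (metis of_rat_eq_0_iff)
qed

text \<open>Relations indexed by positions rather than by vectors yield distinctness too: a vector
  repeated at \<open>i\<close> and \<open>j\<close> gives the nontrivial relation with coefficients
  1 and -1 there.\<close>

lemma (in vector_space) distinct_independent_listI:
  assumes "\<And>c. (\<Sum>i<length bs. scale (c i) (bs ! i)) = 0 \<Longrightarrow> \<forall>i<length bs. c i = 0"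
  shows "distinct bs \<and> independent (set bs)"
proof
  show dist: "distinct bs"
  proof (rule ccontr)
    assume "\<not> distinct bs"
    then obtain i j where ij: "i < length bs" "j < length bs" "i \<noteq> j" "bs ! i = bs ! j"
      by (auto simp: distinct_conv_nth)
    let ?c = "\<lambda>k. (if k = i then 1 else 0) - (if k = j then 1 else 0)"
    have "(\<Sum>k<length bs. scale (?c k) (bs ! k)) =
        (\<Sum>k<length bs. if k = i then bs ! k else 0) - (\<Sum>k<length bs. if k = j then bs ! k else 0)"
      unfolding sum_subtractf [symmetric] by (rule sum.cong) auto
    also have "\<dots> = 0"
      using ij by simp
    finally show False
      using assms[of ?c] ij by auto
  qed
  show "independent (set bs)"
  proof (rule independent_if_scalars_zero)
    fix f x
    assume f: "(\<Sum>x\<in>set bs. scale (f x) x) = 0" and x: "x \<in> set bs"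
    have "(\<Sum>i<length bs. scale (f (bs ! i)) (bs ! i)) = (\<Sum>x\<in>set bs. scale (f x) x)"
      using sum.reindex_bij_betw[OF bij_betw_nth[OF dist refl refl]] by simp
    with f assms[of "\<lambda>i. f (bs ! i)"] x show "f x = 0"
      by (auto simp: in_set_conv_nth)
  qed simp
qed

text \<open>Coordinates in a basis are unique, so expanding the images of the basis vectors
  certifies a matrix without any explicit computation of \<open>representation\<close>.\<close>

lemma matrix_wrt_eqI:
  assumes "vector_space scl" "distinct bs" "\<not> module.dependent scl (set bs)"
    and A: "A \<in> carrier_mat (length bs) (length bs)"
    and "\<And>j. j < length bs \<Longrightarrow> \<tau> (bs ! j) = (\<Sum>i<length bs. scl (A $$ (i, j)) (bs ! i))"
  shows "matrix_wrt scl bs \<tau> = A"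
proof -
  interpret vector_space scl by fact
  have "representation (set bs) (\<tau> (bs ! j)) (bs ! i) = A $$ (i, j)"
    if ij: "i < length bs" "j < length bs" for i j
  proof -
    have "representation (set bs) (\<tau> (bs ! j)) =
        (\<lambda>b. \<Sum>k<length bs. A $$ (k, j) * representation (set bs) (bs ! k) b)"
      unfolding assms(5)[OF ij(2)]
      using assms(3)
      by (subst representation_sum) (simp_all add: representation_scale span_base span_scale)
    then show ?thesis
      using assms(2,3) ij
      by (simp add: representation_basis nth_eq_iff_index_eq if_distrib[of "\<lambda>x. _ * x"] sum.delta
          cong: if_cong)
  qed
  with A show ?thesis
    by (auto simp: matrix_wrt_def)
qed

lemma eigenvalue_transpose_mat:
  fixes A :: "'a::field mat"
  assumes "A \<in> carrier_mat n n"
  shows "eigenvalue (transpose_mat A) c \<longleftrightarrow> eigenvalue A c"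
  using assms by (simp add: eigenvalue_root_char_poly[of _ n])

text \<open>A left eigenvector of the matrix is an eigenvector of the dual map. This avoids tensoring
  the rational space with the complex numbers.\<close>

lemma complex_eigenvalue_functional:
  assumes "vector_space scl"
    and add: "\<And>x y. x \<in> L \<Longrightarrow> y \<in> L \<Longrightarrow> \<tau> (x + y) = \<tau> x + \<tau> y"
    and scale: "\<And>q x. x \<in> L \<Longrightarrow> \<tau> (scl q x) = scl q (\<tau> x)"
    and clos: "\<And>x. x \<in> L \<Longrightarrow> \<tau> x \<in> L"
    and ev: "complex_eigenvalue scl L \<tau> c"
  obtains \<phi> where "\<And>x y. x \<in> L \<Longrightarrow> y \<in> L \<Longrightarrow> \<phi> (x + y) = \<phi> x + \<phi> y"
    and "\<And>q x. x \<in> L \<Longrightarrow> \<phi> (scl q x) = of_rat q * \<phi> x"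
    and "\<And>x. x \<in> L \<Longrightarrow> \<phi> (\<tau> x) = c * \<phi> x"
    and "\<exists>x\<in>L. \<phi> x \<noteq> (0 :: complex)"
proof -
  interpret vector_space scl by fact
  obtain bs where dist: "distinct bs" and ind: "independent (set bs)" and sp: "span (set bs) = L"
    and "eigenvalue (map_mat of_rat (matrix_wrt scl bs \<tau>)) c"
    using ev unfolding complex_eigenvalue_def ordered_basis_def by blast
  define n where "n = length bs"
  define M where "M = matrix_wrt scl bs \<tau>"
  have M: "M \<in> carrier_mat n n"
    by (simp add: M_def matrix_wrt_def n_def)
  have "eigenvalue (transpose_mat (map_mat of_rat M)) c"
    using \<open>eigenvalue _ c\<close> M by (subst eigenvalue_transpose_mat[of _ n]) (simp_all add: M_def)
  then obtain u where u: "u \<in> carrier_vec n" "u \<noteq> 0\<^sub>v n"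
    and eig: "transpose_mat (map_mat of_rat M) *\<^sub>v u = c \<cdot>\<^sub>v u"
    using M by (auto simp: eigenvalue_def eigenvector_def)
  let ?R = "representation (set bs)"
  define \<phi> where "\<phi> x = (\<Sum>i<n. of_rat (?R x (bs ! i)) * vec_index u i)" for x
  have \<phi>_add: "\<phi> (x + y) = \<phi> x + \<phi> y" if "x \<in> L" "y \<in> L" for x y
    using that ind sp
    by (simp add: \<phi>_def representation_add of_rat_add distrib_right sum.distrib)
  have \<phi>_scale: "\<phi> (scl q x) = of_rat q * \<phi> x" if "x \<in> L" for q x
    using that ind sp
    by (simp add: \<phi>_def representation_scale of_rat_mult sum_distrib_left mult.assoc)
  have \<phi>_bs: "\<phi> (bs ! j) = vec_index u j" if "j < n" for j
  proof -
    have "\<phi> (bs ! j) = (\<Sum>i<n. if i = j then vec_index u i else 0)"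
      unfolding \<phi>_def
      using that ind dist
      by (intro sum.cong) (auto simp: representation_basis n_def nth_eq_iff_index_eq)
    then show ?thesis
      using that by simp
  qed
  have \<phi>_\<tau>_bs: "\<phi> (\<tau> (bs ! j)) = c * \<phi> (bs ! j)" if "j < n" for j
  proof -
    \<comment> \<open>Row \<open>j\<close> of the transpose is column \<open>j\<close> of
      \<open>M\<close>, the coordinates of \<open>\<tau> (bs ! j)\<close>; pairing them with
      \<open>u\<close> gives \<open>\<phi>\<close>.\<close>
    have "vec_index (transpose_mat (map_mat of_rat M) *\<^sub>v u) j = \<phi> (\<tau> (bs ! j))"
      using that M u
      by (auto simp: \<phi>_def scalar_prod_def M_def matrix_wrt_def n_def lessThan_atLeast0
          intro!: sum.cong)
    then show ?thesis
      using that u by (simp add: eig \<phi>_bs)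
  qed
  \<comment> \<open>Membership in \<open>L\<close> is carried through the induction because the
    linearity of \<open>\<tau>\<close> and \<open>\<phi>\<close> is known on \<open>L\<close>
    only.\<close>
  have \<phi>_\<tau>: "x \<in> L \<and> \<phi> (\<tau> x) = c * \<phi> x" if "x \<in> L" for x
    using that[folded sp]
  proof (induction rule: span_induct_alt)
    case base
    have "0 \<in> L"
      using sp span_zero by auto
    moreover from this have "\<phi> (\<tau> 0) = \<phi> 0"
      using scale[of 0 0] by simp
    moreover have "\<phi> 0 = 0"
      using \<phi>_scale[of 0 0] \<open>0 \<in> L\<close> by simp
    ultimately show ?case
      by simp
  next
    case (step q b y)
    have b: "b \<in> L"
      using step sp by (auto intro: span_base)
    moreover have L: "scl q b \<in> L" "scl q (\<tau> b) \<in> L"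
      using b clos sp by (metis span_scale)+
    moreover have "\<phi> (\<tau> b) = c * \<phi> b"
      using step(1) \<phi>_\<tau>_bs by (auto simp: in_set_conv_nth n_def)
    moreover have "scl q b + y \<in> L"
      using L step sp by (metis span_add)
    ultimately show ?case
      using step clos by (simp add: add scale \<phi>_add \<phi>_scale algebra_simps)
  qed
  obtain j where "j < n" "vec_index u j \<noteq> 0"
    using u by (metis carrier_vecD eq_vecI index_zero_vec)
  then have "\<exists>x\<in>L. \<phi> x \<noteq> 0"
    using \<phi>_bs sp by (metis n_def nth_mem span_base)
  with \<phi>_add \<phi>_scale \<phi>_\<tau> that show ?thesis
    by blast
qed

section \<open>The bracket in coordinates\<close>

lemma UNIV_basis_index: "UNIV = {V1, V2, V3, V4, V5, V6, W1, W2, W3}"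
  using basis_index.exhaust by auto

lemma U23_bracket_nth:
  "vec_nth (U23_bracket s x y) k =
    (let x = vec_nth x; y = vec_nth y in case k of
       W1 \<Rightarrow> x V3 * y V6 - x V6 * y V3 + s * (x V5 * y V4 - x V4 * y V5)
     | W2 \<Rightarrow> x V5 * y V2 - x V2 * y V5 + s * (x V1 * y V6 - x V6 * y V1)
     | W3 \<Rightarrow> x V1 * y V4 - x V4 * y V1 + s * (x V3 * y V2 - x V2 * y V3)
     | _ \<Rightarrow> 0)"
  unfolding U23_bracket_def UNIV_basis_index
  by (cases k) (simp_all add: U23_basis_bracket_def axis_def Let_def algebra_simps)

lemma vector_space_vec: "vector_space ((*s) :: 'a::field \<Rightarrow> 'a ^ 'n \<Rightarrow> 'a ^ 'n)"
  by unfold_locales (simp_all add: Finite_Cartesian_Product.vec_eq_iff algebra_simps)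

text \<open>Brackets have only \<open>W\<close> coordinates and depend only on \<open>V\<close>
  coordinates. Hence every nested bracket vanishes, and with it each term of the Jacobi
  identity.\<close>

lemma lie_algebra_U23: "lie_algebra (*s) (U23_bracket s) UNIV"
proof -
  interpret v: vector_space "(*s) :: complex \<Rightarrow> complex ^ basis_index \<Rightarrow> _"
    by (rule vector_space_vec)
  show ?thesis
    by unfold_locales
      (simp_all add: vec.subspace_UNIV Finite_Cartesian_Product.vec_eq_iff U23_bracket_nth Let_def
        algebra_simps split: basis_index.split)
qed

section \<open>Vectors of conjugates and multiplication by a unit\<close>

definition eval_rat :: "rat poly \<Rightarrow> complex \<Rightarrow> complex" where
  "eval_rat f t = poly (map_poly of_rat f) t"

interpretation of_rat_poly_hom: map_poly_comm_ring_hom "of_rat :: rat \<Rightarrow> complex" ..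

lemma eval_rat_simps [simp]:
  "eval_rat 0 t = 0"
  "eval_rat 1 t = 1"
  "eval_rat (pCons a f) t = of_rat a + t * eval_rat f t"
  "eval_rat (f + g) t = eval_rat f t + eval_rat g t"
  "eval_rat (f - g) t = eval_rat f t - eval_rat g t"
  "eval_rat (f * g) t = eval_rat f t * eval_rat g t"
  "eval_rat (Polynomial.smult a f) t = of_rat a * eval_rat f t"
  by (simp_all add: eval_rat_def of_rat_poly_hom.hom_add of_rat_poly_hom.hom_minus
      of_rat_poly_hom.hom_mult of_rat_hom.map_poly_pCons_hom of_rat_hom.map_poly_hom_smult)

lemma eval_rat_pcompose: "eval_rat (pcompose f g) t = eval_rat f (eval_rat g t)"
  by (induction f) (simp_all add: pcompose_pCons)

text \<open>Squaring and subtracting 2 permutes the roots of \<open>x\<^sup>3 - 3x + 1\<close> cyclically, since these are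
  \<open>2 cos(2\<pi>/9)\<close>, \<open>2 cos(4\<pi>/9)\<close> and \<open>2 cos(8\<pi>/9)\<close>.\<close>

primrec galois_conj :: "complex \<Rightarrow> basis_index \<Rightarrow> complex" where
  "galois_conj \<theta> V1 = \<theta>" | "galois_conj \<theta> V3 = \<theta>\<^sup>2 - 2" | "galois_conj \<theta> V5 = 2 - \<theta> - \<theta>\<^sup>2"
| "galois_conj \<theta> V2 = \<theta>" | "galois_conj \<theta> V4 = \<theta>\<^sup>2 - 2" | "galois_conj \<theta> V6 = 2 - \<theta> - \<theta>\<^sup>2"
| "galois_conj \<theta> W1 = \<theta>" | "galois_conj \<theta> W2 = \<theta>\<^sup>2 - 2" | "galois_conj \<theta> W3 = 2 - \<theta> - \<theta>\<^sup>2"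

primrec component :: "'a \<Rightarrow> 'a \<Rightarrow> 'a \<Rightarrow> basis_index \<Rightarrow> 'a" where
  "component f g h V1 = f" | "component f g h V3 = f" | "component f g h V5 = f"
| "component f g h V2 = g" | "component f g h V4 = g" | "component f g h V6 = g"
| "component f g h W1 = h" | "component f g h W2 = h" | "component f g h W3 = h"

text \<open>A field element is represented by a rational polynomial with that value at
  \<open>\<theta>\<close>. Evaluating the same polynomial at the other conjugates replaces a
  construction of the field and its automorphisms.\<close>

definition conj_vec :: "complex \<Rightarrow> rat poly \<Rightarrow> rat poly \<Rightarrow> rat poly \<Rightarrow> complex ^ basis_index" where
  "conj_vec \<theta> f g h = vec_lambda (\<lambda>i. eval_rat (component f g h i) (galois_conj \<theta> i))"

definition conj_basis :: "complex \<Rightarrow> (complex ^ basis_index) list" where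
  "conj_basis \<theta> =
     [conj_vec \<theta> 1 0 0, conj_vec \<theta> [:0, 1:] 0 0, conj_vec \<theta> [:0, 0, 1:] 0 0,
      conj_vec \<theta> 0 1 0, conj_vec \<theta> 0 [:0, 1:] 0, conj_vec \<theta> 0 [:0, 0, 1:] 0,
      conj_vec \<theta> 0 0 1, conj_vec \<theta> 0 0 [:0, 1:], conj_vec \<theta> 0 0 [:0, 0, 1:]]"

text \<open>On the center the weight is the product of the other two conjugates of \<open>\<theta>\<close>,
  which is \<open>-1/\<theta> = \<theta>\<^sup>2 - 3\<close>.\<close>

definition unit_map :: "complex \<Rightarrow> complex ^ basis_index \<Rightarrow> complex ^ basis_index" where
  "unit_map \<theta> x = vec_lambda (\<lambda>i.
     component (galois_conj \<theta> i) (galois_conj \<theta> i) ((galois_conj \<theta> i)\<^sup>2 - 3) i * vec_nth x i)"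

text \<open>The blocks are multiplication by \<open>\<theta>\<close>, \<open>\<theta>\<close> and
  \<open>\<theta>^2 - 3\<close> in the basis \<open>1, \<theta>, \<theta>^2\<close>, reduced by
  \<open>\<theta>^3 = 3 * \<theta> - 1\<close>.\<close>

definition unit_mat :: "int mat" where
  "unit_mat = mat 9 9 (\<lambda>(i, j). if i div 3 = j div 3 then
     [[[0, 0, -1], [1, 0, 3], [0, 1, 0]],
      [[0, 0, -1], [1, 0, 3], [0, 1, 0]],
      [[-3, -1, 0], [0, 0, -1], [1, 0, 0]]] ! (i div 3) ! (i mod 3) ! (j mod 3) else 0)"

text \<open>The blocks are multiplication by the inverse units \<open>3 - \<theta>^2\<close>,
  \<open>3 - \<theta>^2\<close> and \<open>- \<theta>\<close>.\<close>

definition unit_mat_inv :: "int mat" where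
  "unit_mat_inv = mat 9 9 (\<lambda>(i, j). if i div 3 = j div 3 then
     [[[3, 1, 0], [0, 0, 1], [-1, 0, 0]],
      [[3, 1, 0], [0, 0, 1], [-1, 0, 0]],
      [[0, 0, 1], [-1, 0, -3], [0, -1, 0]]] ! (i div 3) ! (i mod 3) ! (j mod 3) else 0)"

lemma lessThan_9: "{..<9::nat} = {0, 1, 2, 3, 4, 5, 6, 7, 8}"
  by auto

lemma unit_mat_dim:
  "dim_row unit_mat = 9" "dim_col unit_mat = 9"
  "dim_row unit_mat_inv = 9" "dim_col unit_mat_inv = 9"
  by (simp_all add: unit_mat_def unit_mat_inv_def)

lemma unit_mat_mult_inv: "unit_mat * unit_mat_inv = 1\<^sub>m 9"
proof -
  \<comment> \<open>Indices and sums range over explicit lists, so that the simplifier can compute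
    all 81 entries.\<close>
  have "\<forall>i\<in>set [0..<9]. \<forall>j\<in>set [0..<9].
      (\<Sum>k\<leftarrow>[0..<9]. unit_mat $$ (i, k) * unit_mat_inv $$ (k, j)) = (if i = j then 1 else 0)"
    unfolding unit_mat_def unit_mat_inv_def by (simp add: upt_rec)
  then show ?thesis
    unfolding interv_sum_list_conv_sum_set_nat
    by (intro eq_matI) (simp_all add: unit_mat_dim scalar_prod_def)
qed

lemma unit_mat_inv_mult: "unit_mat_inv * unit_mat = 1\<^sub>m 9"
proof -
  have "\<forall>i\<in>set [0..<9]. \<forall>j\<in>set [0..<9].
      (\<Sum>k\<leftarrow>[0..<9]. unit_mat_inv $$ (i, k) * unit_mat $$ (k, j)) = (if i = j then 1 else 0)"
    unfolding unit_mat_def unit_mat_inv_def by (simp add: upt_rec)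
  then show ?thesis
    unfolding interv_sum_list_conv_sum_set_nat
    by (intro eq_matI) (simp_all add: unit_mat_dim scalar_prod_def)
qed

lemma invertible_unit_mat: "invertible_mat unit_mat"
  using unit_mat_mult_inv unit_mat_inv_mult
  by (auto simp: invertible_mat_def inverts_mat_def unit_mat_dim)

lemma basis_vec_eqI: "(\<And>i. vec_nth x i = vec_nth y i) \<Longrightarrow> x = y"
  for x y :: "'a ^ basis_index"
  by (simp add: Finite_Cartesian_Product.vec_eq_iff)

lemma conj_vec_add:
  "conj_vec \<theta> f g h + conj_vec \<theta> f' g' h' = conj_vec \<theta> (f + f') (g + g') (h + h')"
  by (rule basis_vec_eqI, rename_tac i, case_tac i) (simp_all add: conj_vec_def)

lemma conj_vec_scale:
  "rat_scale (*s) q (conj_vec \<theta> f g h) =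
     conj_vec \<theta> (Polynomial.smult q f) (Polynomial.smult q g) (Polynomial.smult q h)"
  by (rule basis_vec_eqI, rename_tac i, case_tac i) (simp_all add: conj_vec_def rat_scale_def)

lemma unit_map_add: "unit_map \<theta> (x + y) = unit_map \<theta> x + unit_map \<theta> y"
  by (simp add: Finite_Cartesian_Product.vec_eq_iff unit_map_def distrib_left)

lemma unit_map_scale: "unit_map \<theta> (c *s x) = c *s unit_map \<theta> x"
  by (simp add: Finite_Cartesian_Product.vec_eq_iff unit_map_def)

lemma unit_map_conj_vec:
  "unit_map \<theta> (conj_vec \<theta> f g h) =
     conj_vec \<theta> ([:0, 1:] * f) ([:0, 1:] * g) ([:-3, 0, 1:] * h)"
  by (rule basis_vec_eqI, rename_tac i, case_tac i)
    (simp_all add: unit_map_def conj_vec_def power2_eq_square del: mult_pCons_left)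

section \<open>Arithmetic modulo the cubic\<close>

locale cubic_unit =
  fixes \<theta> :: complex
  assumes cubic: "\<theta> ^ 3 = 3 * \<theta> - 1"
begin

text \<open>Used as rewrite rules on right-associated products; the second one covers powers
  followed by a further factor.\<close>

lemma cubic_reduce:
  "\<theta> * (\<theta> * \<theta>) = 3 * \<theta> - 1"
  "\<theta> * (\<theta> * (\<theta> * x)) = 3 * (\<theta> * x) - x"
proof -
  show "\<theta> * (\<theta> * \<theta>) = 3 * \<theta> - 1"
    using cubic by (simp add: power3_eq_cube mult.assoc)
  then have "\<theta> * (\<theta> * \<theta>) * x = (3 * \<theta> - 1) * x"
    by simp
  then show "\<theta> * (\<theta> * (\<theta> * x)) = 3 * (\<theta> * x) - x"
    by (simp add: left_diff_distrib mult.assoc)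
qed

lemma galois_conj_cubic: "galois_conj \<theta> i ^ 3 = 3 * galois_conj \<theta> i - 1"
  by (cases i) (simp_all add: power2_eq_square power3_eq_cube algebra_simps cubic_reduce)

lemma conjugates_distinct:
  "\<theta> \<noteq> \<theta>\<^sup>2 - 2" "\<theta>\<^sup>2 - 2 \<noteq> 2 - \<theta> - \<theta>\<^sup>2" "\<theta> \<noteq> 2 - \<theta> - \<theta>\<^sup>2"
proof -
  \<comment> \<open>The product of the differences is a square root of the discriminant 81 of the
    cubic, hence nonzero.\<close>
  have "(\<theta> - (\<theta>\<^sup>2 - 2)) * ((\<theta>\<^sup>2 - 2) - (2 - \<theta> - \<theta>\<^sup>2)) * (\<theta> - (2 - \<theta> - \<theta>\<^sup>2)) = 9"
    by (simp add: power2_eq_square algebra_simps cubic_reduce)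
  then show "\<theta> \<noteq> \<theta>\<^sup>2 - 2" "\<theta>\<^sup>2 - 2 \<noteq> 2 - \<theta> - \<theta>\<^sup>2" "\<theta> \<noteq> 2 - \<theta> - \<theta>\<^sup>2"
    by auto
qed

text \<open>Each term of a central coordinate pairs entries at the two conjugates other than its
  own, so it is scaled by their product. By \<open>prods\<close> this is exactly the weight on the
  center.\<close>

lemma unit_map_bracket:
  "unit_map \<theta> (U23_bracket s x y) = U23_bracket s (unit_map \<theta> x) (unit_map \<theta> y)"
proof -
  define a b c where "a = \<theta>" "b = \<theta>\<^sup>2 - 2" "c = 2 - \<theta> - \<theta>\<^sup>2"
  have conjs: "\<theta> = a" "a\<^sup>2 - 2 = b" "2 - a - a\<^sup>2 = c"
    by (simp_all add: a_b_c_def)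
  have prods: "a\<^sup>2 - 3 = b * c" "b\<^sup>2 - 3 = c * a" "c\<^sup>2 - 3 = a * b"
    by (simp_all add: a_b_c_def power2_eq_square algebra_simps cubic_reduce)
  show ?thesis
    by (rule basis_vec_eqI, rename_tac i, case_tac i)
      (simp_all only: unit_map_def U23_bracket_nth Let_def conjs prods vec_lambda_beta
        basis_index.case galois_conj.simps component.simps mult_zero_right, simp_all add: algebra_simps)
qed

end

section \<open>The rational form and its basis\<close>

definition unit_map_inv :: "complex \<Rightarrow> complex ^ basis_index \<Rightarrow> complex ^ basis_index" where
  "unit_map_inv \<theta> x = vec_lambda (\<lambda>i.
     component (3 - (galois_conj \<theta> i)\<^sup>2) (3 - (galois_conj \<theta> i)\<^sup>2) (- galois_conj \<theta> i) i * vec_nth x i)"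

text \<open>Without a degree bound on the polynomials, closure under products is immediate;
  reduction to degree at most 2 is only needed for the span.\<close>

definition conj_form :: "complex \<Rightarrow> (complex ^ basis_index) set" where
  "conj_form \<theta> = {x. \<exists>f g h. x = conj_vec \<theta> f g h}"

lemma conj_formI: "conj_vec \<theta> f g h \<in> conj_form \<theta>"
  by (auto simp: conj_form_def)

lemma unit_map_inv_conj_vec:
  "unit_map_inv \<theta> (conj_vec \<theta> f g h) =
     conj_vec \<theta> ([:3, 0, -1:] * f) ([:3, 0, -1:] * g) ([:0, -1:] * h)"
  by (rule basis_vec_eqI, rename_tac i, case_tac i)
    (simp_all add: unit_map_inv_def conj_vec_def power2_eq_square of_rat_minus del: mult_pCons_left,
      simp_all add: algebra_simps)

lemma length_conj_basis: "length (conj_basis \<theta>) = 9"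
  by (simp add: conj_basis_def)

lemma unit_map_conj_form: "x \<in> conj_form \<theta> \<Longrightarrow> unit_map \<theta> x \<in> conj_form \<theta>"
  unfolding conj_form_def using unit_map_conj_vec by blast

lemma unit_map_inv_conj_form: "x \<in> conj_form \<theta> \<Longrightarrow> unit_map_inv \<theta> x \<in> conj_form \<theta>"
  unfolding conj_form_def using unit_map_inv_conj_vec by blast

lemma vector_space_rat_vec:
  "vector_space (rat_scale ((*s) :: complex \<Rightarrow> complex ^ basis_index \<Rightarrow> complex ^ basis_index))"
  by (rule vector_space_rat_scale [OF vector_space_vec])

lemma subspace_conj_form: "module.subspace (rat_scale (*s)) (conj_form \<theta>)"
proof -
  interpret q: vector_space "rat_scale ((*s) :: complex \<Rightarrow> complex ^ basis_index \<Rightarrow> _)"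
    by (rule vector_space_rat_vec)
  have "0 = conj_vec \<theta> 0 0 0"
    by (rule basis_vec_eqI, rename_tac i, case_tac i) (simp_all add: conj_vec_def)
  then show ?thesis
    unfolding q.subspace_def by (auto simp: conj_form_def conj_vec_add conj_vec_scale; blast?)
qed

text \<open>Divided differences eliminate \<open>p\<close>, then \<open>q\<close>: this is the
  invertibility of a 3 by 3 Vandermonde matrix.\<close>

lemma quadratic_three_roots:
  fixes x y z :: "'a::field"
  assumes "x \<noteq> y" "y \<noteq> z" "x \<noteq> z"
    and "p + x * q + x\<^sup>2 * r = 0" "p + y * q + y\<^sup>2 * r = 0" "p + z * q + z\<^sup>2 * r = 0"
  shows "p = 0" "q = 0" "r = 0"
proof -
  have "(x - y) * (q + (x + y) * r) = (p + x * q + x\<^sup>2 * r) - (p + y * q + y\<^sup>2 * r)"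
    "(x - z) * (q + (x + z) * r) = (p + x * q + x\<^sup>2 * r) - (p + z * q + z\<^sup>2 * r)"
    by (simp_all add: power2_eq_square algebra_simps)
  then have *: "q + (x + y) * r = 0" "q + (x + z) * r = 0"
    using assms by simp_all
  have "(y - z) * r = (q + (x + y) * r) - (q + (x + z) * r)"
    by (simp add: algebra_simps)
  then have "(y - z) * r = 0"
    using * by simp
  then show "r = 0"
    using assms(2) by simp
  with * show "q = 0"
    by simp
  with \<open>r = 0\<close> assms(4) show "p = 0"
    by simp
qed

context cubic_unit begin

text \<open>The weights are mutually inverse because \<open>\<theta> * (3 - \<theta>^2) = 1\<close>,
  and likewise for the other conjugates.\<close>

lemma unit_map_inverse:
  "unit_map_inv \<theta> (unit_map \<theta> x) = x" "unit_map \<theta> (unit_map_inv \<theta> x) = x"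
  by (rule basis_vec_eqI, rename_tac i, case_tac i;
      simp add: unit_map_def unit_map_inv_def power2_eq_square algebra_simps cubic_reduce)+

lemma bij_unit_map: "bij_betw (unit_map \<theta>) (conj_form \<theta>) (conj_form \<theta>)"
proof (rule bij_betw_byWitness [where f' = "unit_map_inv \<theta>"])
  show "unit_map \<theta> ` conj_form \<theta> \<subseteq> conj_form \<theta>"
    using unit_map_conj_form by blast
  show "unit_map_inv \<theta> ` conj_form \<theta> \<subseteq> conj_form \<theta>"
    using unit_map_inv_conj_form by blast
qed (simp_all add: unit_map_inverse)

text \<open>In each block a relation says that a polynomial of degree at most 2 vanishes at the
  three distinct conjugates. Proving independence over the complex numbers gives it over the
  rationals as well.\<close>

lemma distinct_independent_conj_basis:
  "distinct (conj_basis \<theta>) \<and> vec.independent (set (conj_basis \<theta>))"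
proof (rule vec.distinct_independent_listI, intro allI impI)
  fix c :: "nat \<Rightarrow> complex" and i
  assume sum: "(\<Sum>i<length (conj_basis \<theta>). c i *s conj_basis \<theta> ! i) = 0"
    and i: "i < length (conj_basis \<theta>)"
  note roots = quadratic_three_roots [OF conjugates_distinct]
  have *: "c 0 * vec_nth (conj_vec \<theta> 1 0 0) k + c 1 * vec_nth (conj_vec \<theta> [:0, 1:] 0 0) k
      + c 2 * vec_nth (conj_vec \<theta> [:0, 0, 1:] 0 0) k
      + (c 3 * vec_nth (conj_vec \<theta> 0 1 0) k + c 4 * vec_nth (conj_vec \<theta> 0 [:0, 1:] 0) k
      + c 5 * vec_nth (conj_vec \<theta> 0 [:0, 0, 1:] 0) k)
      + (c 6 * vec_nth (conj_vec \<theta> 0 0 1) k + c 7 * vec_nth (conj_vec \<theta> 0 0 [:0, 1:]) k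
      + c 8 * vec_nth (conj_vec \<theta> 0 0 [:0, 0, 1:]) k) = 0" for k
    using arg_cong [OF sum [unfolded length_conj_basis lessThan_9], of "\<lambda>x. vec_nth x k"]
    by (simp add: conj_basis_def add.assoc)
  have "c 0 = 0" "c 1 = 0" "c 2 = 0"
    by (rule roots [of "c 0" "c 1" "c 2"];
        use *[of V1] *[of V3] *[of V5] in
          \<open>simp add: conj_vec_def power2_eq_square [of "_ - _"] power2_eq_square [of \<theta>] mult.commute mult.left_commute\<close>)+
  moreover have "c 3 = 0" "c 4 = 0" "c 5 = 0"
    by (rule roots [of "c 3" "c 4" "c 5"];
        use *[of V2] *[of V4] *[of V6] in
          \<open>simp add: conj_vec_def power2_eq_square [of "_ - _"] power2_eq_square [of \<theta>] mult.commute mult.left_commute\<close>)+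
  moreover have "c 6 = 0" "c 7 = 0" "c 8 = 0"
    by (rule roots [of "c 6" "c 7" "c 8"];
        use *[of W1] *[of W2] *[of W3] in
          \<open>simp add: conj_vec_def power2_eq_square [of "_ - _"] power2_eq_square [of \<theta>] mult.commute mult.left_commute\<close>)+
  moreover have "i \<in> {..<9}"
    using i by (simp add: length_conj_basis)
  ultimately show "c i = 0"
    unfolding lessThan_9 by auto
qed

text \<open>Nine independent vectors in dimension nine span.\<close>

lemma span_conj_basis_complex: "vec.span (set (conj_basis \<theta>)) = UNIV"
proof -
  have "card (set (conj_basis \<theta>)) = 9"
    using distinct_independent_conj_basis by (simp add: distinct_card length_conj_basis)
  moreover have "vec.dim (UNIV :: (complex ^ basis_index) set) = 9"
    by (simp add: card_cart_basis UNIV_basis_index)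
  ultimately show ?thesis
    using vec.card_ge_dim_independent [of "set (conj_basis \<theta>)" UNIV] distinct_independent_conj_basis
    by auto
qed

text \<open>The modulus is \<open>x^3 - 3 * x + 1\<close>, which vanishes at every conjugate, so a
  remainder keeps the values.\<close>

lemma eval_rat_mod:
  "eval_rat (f mod [:1, -3, 0, 1:]) (galois_conj \<theta> i) = eval_rat f (galois_conj \<theta> i)"
proof -
  let ?t = "galois_conj \<theta> i" and ?m = "[:1, -3, 0, 1:] :: rat poly"
  have root: "eval_rat ?m ?t = 0"
    using galois_conj_cubic [of i] by (simp add: power3_eq_cube of_rat_minus algebra_simps)
  have "f = ?m * (f div ?m) + f mod ?m"
    by (rule mult_div_mod_eq [symmetric])
  then have "eval_rat f ?t = eval_rat ?m ?t * eval_rat (f div ?m) ?t + eval_rat (f mod ?m) ?t"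
    by (metis eval_rat_simps(4,6))
  then show ?thesis
    unfolding root by simp
qed

lemma conj_form_quadratic:
  assumes "x \<in> conj_form \<theta>"
  obtains a b c a' b' c' a'' b'' c''
  where "x = conj_vec \<theta> [:a, b, c:] [:a', b', c':] [:a'', b'', c'':]"
proof -
  let ?m = "[:1, -3, 0, 1:] :: rat poly"
  have quad: "\<exists>a b c. f mod ?m = [:a, b, c:]" for f
  proof -
    have "degree (f mod ?m) < 3"
      using degree_mod_less [of ?m f] by auto
    then have "f mod ?m = [:coeff (f mod ?m) 0, coeff (f mod ?m) 1, coeff (f mod ?m) 2:]"
      by (intro poly_eqI) (auto simp: coeff_pCons coeff_eq_0 numeral_2_eq_2 split: nat.split)
    then show ?thesis
      by blast
  qed
  obtain f g h where "x = conj_vec \<theta> f g h"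
    using assms by (auto simp: conj_form_def)
  moreover have "conj_vec \<theta> f g h = conj_vec \<theta> (f mod ?m) (g mod ?m) (h mod ?m)"
  proof (rule basis_vec_eqI)
    show "vec_nth (conj_vec \<theta> f g h) i = vec_nth (conj_vec \<theta> (f mod ?m) (g mod ?m) (h mod ?m)) i"
      for i using eval_rat_mod [of _ i] by (cases i) (simp_all add: conj_vec_def)
  qed
  ultimately show ?thesis
    using quad that by metis
qed

lemma span_conj_basis_rat: "module.span (rat_scale (*s)) (set (conj_basis \<theta>)) = conj_form \<theta>"
proof -
  interpret q: vector_space "rat_scale ((*s) :: complex \<Rightarrow> complex ^ basis_index \<Rightarrow> _)"
    by (rule vector_space_rat_vec)
  show ?thesis
  proof (rule q.span_unique)
    show "set (conj_basis \<theta>) \<subseteq> conj_form \<theta>"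
      by (auto simp: conj_basis_def conj_formI)
    show "q.subspace (conj_form \<theta>)"
      by (rule subspace_conj_form)
  next
    fix S assume S: "set (conj_basis \<theta>) \<subseteq> S" "q.subspace S"
    have *: "rat_scale (*s) a (conj_basis \<theta> ! i) \<in> S" if "i < 9" for a i
      using S that nth_mem [of i "conj_basis \<theta>"]
      by (intro q.subspace_scale) (auto simp: length_conj_basis)
    show "conj_form \<theta> \<subseteq> S"
    proof
      fix x assume "x \<in> conj_form \<theta>"
      then obtain a b c a' b' c' a'' b'' c''
        where "x = conj_vec \<theta> [:a, b, c:] [:a', b', c':] [:a'', b'', c'':]"
        by (rule conj_form_quadratic)
      also have "\<dots> = (\<Sum>i<9. rat_scale (*s) ([a, b, c, a', b', c', a'', b'', c''] ! i) (conj_basis \<theta> ! i))"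
        by (simp add: lessThan_9 conj_basis_def conj_vec_add conj_vec_scale)
      also have "\<dots> \<in> S"
        using S(2) * by (intro q.subspace_sum) auto
      finally show "x \<in> S" .
    qed
  qed
qed

end

section \<open>The bracket on the rational form\<close>

text \<open>The polynomial \<open>2 - t - t\<^sup>2\<close> stands for \<open>\<sigma>\<^sup>2t = (t\<^sup>2 - 2)\<^sup>2 - 2\<close>, reduced modulo the
  minimal polynomial.\<close>

definition galois_product :: "rat \<Rightarrow> rat poly \<Rightarrow> rat poly \<Rightarrow> rat poly" where
  "galois_product r f g =
     pcompose f [:-2, 0, 1:] * pcompose g [:2, -1, -1:]
     + Polynomial.smult r (pcompose f [:2, -1, -1:] * pcompose g [:-2, 0, 1:])"

lemma eval_rat_galois_product:
  "eval_rat (galois_product r f g) t =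
     eval_rat f (t\<^sup>2 - 2) * eval_rat g (2 - t - t\<^sup>2)
     + of_rat r * (eval_rat f (2 - t - t\<^sup>2) * eval_rat g (t\<^sup>2 - 2))"
proof -
  have shifts: "eval_rat [:-2, 0, 1:] t = t\<^sup>2 - 2" "eval_rat [:2, -1, -1:] t = 2 - t - t\<^sup>2"
    by (simp_all add: of_rat_minus power2_eq_square algebra_simps)
  show ?thesis
    by (simp only: galois_product_def eval_rat_pcompose eval_rat_simps(4,6,7) shifts)
qed

context cubic_unit begin

text \<open>The three central coordinates are conjugates of one field element because a rational
  \<open>r\<close> is fixed by the Galois group. The two products come from the two orders of
  pairing the noncentral blocks.\<close>

lemma conj_vec_bracket:
  "U23_bracket (of_rat r) (conj_vec \<theta> f g h) (conj_vec \<theta> f' g' h') =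
     conj_vec \<theta> 0 0 (galois_product r f g' - galois_product r f' g)"
proof -
  define a b c where "a = \<theta>" "b = \<theta>\<^sup>2 - 2" "c = 2 - \<theta> - \<theta>\<^sup>2"
  have conjs: "\<theta> = a" "a\<^sup>2 - 2 = b" "2 - a - a\<^sup>2 = c"
    by (simp_all add: a_b_c_def)
  \<comment> \<open>The expressions for the two nontrivial Galois automorphisms permute the
    conjugates cyclically; this closes the computation on the letters \<open>a\<close>,
    \<open>b\<close>, \<open>c\<close>.\<close>
  have cycle: "b\<^sup>2 - 2 = c" "2 - b - b\<^sup>2 = a" "c\<^sup>2 - 2 = a" "2 - c - c\<^sup>2 = b"
    by (simp_all add: a_b_c_def power2_eq_square algebra_simps cubic_reduce)
  show ?thesis
    by (rule basis_vec_eqI, rename_tac i, case_tac i)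
      (simp_all only: conj_vec_def U23_bracket_nth Let_def conjs cycle vec_lambda_beta
        basis_index.case galois_conj.simps component.simps eval_rat_simps eval_rat_galois_product,
       simp_all add: algebra_simps)
qed

lemma lie_algebra_conj_form: "lie_algebra (rat_scale (*s)) (U23_bracket (of_rat r)) (conj_form \<theta>)"
proof (rule lie_algebra_rat_scale [OF lie_algebra_U23 subspace_conj_form])
  show "U23_bracket (of_rat r) x y \<in> conj_form \<theta>" if "x \<in> conj_form \<theta>" "y \<in> conj_form \<theta>" for x y
    using that conj_vec_bracket unfolding conj_form_def by blast
qed simp

lemma rational_form_conj_form:
  "rational_form (*s) (U23_bracket (of_rat r)) UNIV (conj_form \<theta>)"
  unfolding rational_form_def
  using lie_algebra_conj_form distinct_independent_conj_basis span_conj_basis_rat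
    span_conj_basis_complex independent_rat_scale [OF vector_space_vec]
  by blast

section \<open>The automorphism and its hyperbolicity\<close>

lemma unit_map_rat_scale: "unit_map \<theta> (rat_scale (*s) q x) = rat_scale (*s) q (unit_map \<theta> x)"
  by (simp add: rat_scale_def unit_map_scale)

lemma lie_automorphism_unit_map:
  "lie_automorphism (rat_scale (*s)) (U23_bracket (of_rat r)) (conj_form \<theta>) (unit_map \<theta>)"
  unfolding lie_automorphism_def
  by (simp add: bij_unit_map unit_map_add unit_map_rat_scale unit_map_bracket)

text \<open>The weights are roots of \<open>x^3 - 3 * x + 1\<close> off the center and of
  \<open>x^3 + 3 * x^2 - 1\<close> on it. As vector identities these relations can be fed to an
  eigenfunctional, which turns them into equations for the eigenvalue.\<close>

lemma unit_map_cubic_relations: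
  "unit_map \<theta> (unit_map \<theta> (unit_map \<theta> (conj_vec \<theta> f g 0))) + conj_vec \<theta> f g 0 =
     rat_scale (*s) 3 (unit_map \<theta> (conj_vec \<theta> f g 0))"
  "unit_map \<theta> (unit_map \<theta> (unit_map \<theta> (conj_vec \<theta> 0 0 h)))
     + rat_scale (*s) 3 (unit_map \<theta> (unit_map \<theta> (conj_vec \<theta> 0 0 h))) = conj_vec \<theta> 0 0 h"
proof -
  have 1: "t * (t * (t * e)) + e = 3 * (t * e)" if "t ^ 3 = 3 * t - 1" for t e :: complex
  proof -
    have "t * (t * (t * e)) = t ^ 3 * e"
      by (simp add: power3_eq_cube)
    then show ?thesis
      by (simp add: that algebra_simps)
  qed
  have 2: "(t\<^sup>2 - 3) * ((t\<^sup>2 - 3) * ((t\<^sup>2 - 3) * e)) + 3 * ((t\<^sup>2 - 3) * ((t\<^sup>2 - 3) * e)) = e"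
    if "t ^ 3 = 3 * t - 1" for t e :: complex
  proof -
    \<comment> \<open>The left side is \<open>(t^2 - 3)^2 * t^2 = (t^3 - 3 * t)^2\<close>, and
      \<open>t^3 - 3 * t = -1\<close>.\<close>
    have "(t\<^sup>2 - 3) ^ 3 + 3 * (t\<^sup>2 - 3)\<^sup>2 = (t ^ 3)\<^sup>2 - 6 * (t * t ^ 3) + 9 * t\<^sup>2"
      by (simp add: power2_eq_square power3_eq_cube algebra_simps)
    also have "\<dots> = 1"
      by (simp add: that power2_eq_square algebra_simps)
    finally have "((t\<^sup>2 - 3) ^ 3 + 3 * (t\<^sup>2 - 3)\<^sup>2) * e = e"
      by simp
    then show ?thesis
      by (simp add: power2_eq_square power3_eq_cube distrib_right mult.assoc)
  qed
  note cubes = galois_conj_cubic [of V1] galois_conj_cubic [of V3] galois_conj_cubic [of V5]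
  show "unit_map \<theta> (unit_map \<theta> (unit_map \<theta> (conj_vec \<theta> f g 0))) + conj_vec \<theta> f g 0 =
     rat_scale (*s) 3 (unit_map \<theta> (conj_vec \<theta> f g 0))"
    using cubes [simplified]
    by (intro basis_vec_eqI, rename_tac i, case_tac i)
      (simp_all add: unit_map_def conj_vec_def rat_scale_def 1)
  show "unit_map \<theta> (unit_map \<theta> (unit_map \<theta> (conj_vec \<theta> 0 0 h)))
     + rat_scale (*s) 3 (unit_map \<theta> (unit_map \<theta> (conj_vec \<theta> 0 0 h))) = conj_vec \<theta> 0 0 h"
    using cubes [simplified]
    by (intro basis_vec_eqI, rename_tac i, case_tac i)
      (simp_all add: unit_map_def conj_vec_def rat_scale_def 2)
qed

lemma hyperbolic_unit_map: "hyperbolic (rat_scale (*s)) (conj_form \<theta>) (unit_map \<theta>)"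
  unfolding hyperbolic_def
proof (intro allI impI notI)
  fix c
  assume ev: "complex_eigenvalue (rat_scale (*s)) (conj_form \<theta>) (unit_map \<theta>) c"
    and c: "cmod c = 1"
  obtain \<phi> where
    add: "\<And>x y. x \<in> conj_form \<theta> \<Longrightarrow> y \<in> conj_form \<theta> \<Longrightarrow> \<phi> (x + y) = \<phi> x + \<phi> y"
    and scale: "\<And>q x. x \<in> conj_form \<theta> \<Longrightarrow> \<phi> (rat_scale (*s) q x) = of_rat q * \<phi> x"
    and eig: "\<And>x. x \<in> conj_form \<theta> \<Longrightarrow> \<phi> (unit_map \<theta> x) = c * \<phi> x"
    and nz: "\<exists>x\<in>conj_form \<theta>. \<phi> x \<noteq> 0"
    using complex_eigenvalue_functional
      [OF vector_space_rat_vec unit_map_add unit_map_rat_scale unit_map_conj_form ev]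
    by blast
  have clos: "rat_scale (*s) q x \<in> conj_form \<theta>" if "x \<in> conj_form \<theta>" for q x
    using that conj_vec_scale unfolding conj_form_def by blast
  note rules = add scale eig clos unit_map_conj_form conj_formI
  obtain f g h where "\<phi> (conj_vec \<theta> f g h) \<noteq> 0"
    using nz by (auto simp: conj_form_def)
  moreover have "conj_vec \<theta> f g h = conj_vec \<theta> f g 0 + conj_vec \<theta> 0 0 h"
    by (simp add: conj_vec_add)
  \<comment> \<open>A nonzero functional is nonzero on the noncentral or the central summand, and
    each summand has its own cubic relation.\<close>
  ultimately consider "\<phi> (conj_vec \<theta> f g 0) \<noteq> 0" | "\<phi> (conj_vec \<theta> 0 0 h) \<noteq> 0"
    using add conj_formI by fastforce
  then show False
  proof cases
    case 1
    have "c * (c * (c * \<phi> (conj_vec \<theta> f g 0))) + \<phi> (conj_vec \<theta> f g 0) =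
        3 * (c * \<phi> (conj_vec \<theta> f g 0))"
      using arg_cong [OF unit_map_cubic_relations(1), of \<phi> f g]
      by (simp add: rules)
    then have "(c ^ 3 + 1 - 3 * c) * \<phi> (conj_vec \<theta> f g 0) = 0"
      by (simp add: power3_eq_cube algebra_simps)
    with 1 have "c ^ 3 + 1 = 3 * c"
      by simp
    then have "cmod (c ^ 3 + 1) = 3"
      using c by (simp add: norm_mult)
    moreover have "cmod (c ^ 3 + 1) \<le> 2"
      using norm_triangle_ineq [of "c ^ 3" 1] c by (simp add: norm_power)
    ultimately show False
      by simp
  next
    case 2
    have "c * (c * (c * \<phi> (conj_vec \<theta> 0 0 h))) + 3 * (c * (c * \<phi> (conj_vec \<theta> 0 0 h))) =
        \<phi> (conj_vec \<theta> 0 0 h)"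
      using arg_cong [OF unit_map_cubic_relations(2), of \<phi> h]
      by (simp add: rules)
    then have "(1 - c ^ 3 - 3 * c\<^sup>2) * \<phi> (conj_vec \<theta> 0 0 h) = 0"
      by (simp add: power2_eq_square power3_eq_cube algebra_simps)
    with 2 have "1 - c ^ 3 = 3 * c\<^sup>2"
      by simp
    then have "cmod (1 - c ^ 3) = 3"
      using c by (simp add: norm_mult norm_power)
    moreover have "cmod (1 - c ^ 3) \<le> 2"
      using norm_triangle_ineq4 [of 1 "c ^ 3"] c by (simp add: norm_power)
    ultimately show False
      by simp
  qed
qed

section \<open>Integrality of the automorphism\<close>

lemma unit_map_conj_basis:
  assumes "j < 9"
  shows "unit_map \<theta> (conj_basis \<theta> ! j) =
    (\<Sum>i<9. rat_scale (*s) (of_int (unit_mat $$ (i, j))) (conj_basis \<theta> ! i))"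
proof -
  have scale: "rat_scale (*s) 0 x = 0" "rat_scale (*s) 1 x = x"
    "rat_scale (*s) (-1) x = - x" "rat_scale (*s) 3 x = 3 *s x" "rat_scale (*s) (-3) x = - (3 *s x)"
    for x :: "complex ^ basis_index"
    by (simp_all add: rat_scale_def of_rat_minus)
  \<comment> \<open>These are the columns of \<open>unit_mat\<close>, with all powers above the
    second reduced by the cubic.\<close>
  have red:
    "unit_map \<theta> (conj_vec \<theta> 1 0 0) = conj_vec \<theta> [:0, 1:] 0 0"
    "unit_map \<theta> (conj_vec \<theta> [:0, 1:] 0 0) = conj_vec \<theta> [:0, 0, 1:] 0 0"
    "unit_map \<theta> (conj_vec \<theta> [:0, 0, 1:] 0 0) = 3 *s conj_vec \<theta> [:0, 1:] 0 0 - conj_vec \<theta> 1 0 0"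
    "unit_map \<theta> (conj_vec \<theta> 0 1 0) = conj_vec \<theta> 0 [:0, 1:] 0"
    "unit_map \<theta> (conj_vec \<theta> 0 [:0, 1:] 0) = conj_vec \<theta> 0 [:0, 0, 1:] 0"
    "unit_map \<theta> (conj_vec \<theta> 0 [:0, 0, 1:] 0) = 3 *s conj_vec \<theta> 0 [:0, 1:] 0 - conj_vec \<theta> 0 1 0"
    "unit_map \<theta> (conj_vec \<theta> 0 0 1) = conj_vec \<theta> 0 0 [:0, 0, 1:] - 3 *s conj_vec \<theta> 0 0 1"
    "unit_map \<theta> (conj_vec \<theta> 0 0 [:0, 1:]) = - conj_vec \<theta> 0 0 1"
    "unit_map \<theta> (conj_vec \<theta> 0 0 [:0, 0, 1:]) = - conj_vec \<theta> 0 0 [:0, 1:]"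
    by (rule basis_vec_eqI, rename_tac i, case_tac i;
        simp add: unit_map_def conj_vec_def power2_eq_square algebra_simps cubic_reduce)+
  have "\<forall>j\<in>set [0..<9]. unit_map \<theta> (conj_basis \<theta> ! j) =
      (\<Sum>i\<leftarrow>[0..<9]. rat_scale (*s) (of_int (unit_mat $$ (i, j))) (conj_basis \<theta> ! i))"
    unfolding unit_mat_def conj_basis_def by (simp add: upt_rec red scale)
  then show ?thesis
    using assms unfolding interv_sum_list_conv_sum_set_nat by (simp add: lessThan_atLeast0)
qed

lemma unimodular_unit_map: "unimodular (rat_scale (*s)) (conj_form \<theta>) (unit_map \<theta>)"
  unfolding unimodular_def
proof (intro exI conjI)
  have indep: "\<not> module.dependent (rat_scale (*s)) (set (conj_basis \<theta>))"
    using distinct_independent_conj_basis independent_rat_scale [OF vector_space_vec] by blast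
  then show "ordered_basis (rat_scale (*s)) (conj_form \<theta>) (conj_basis \<theta>)"
    using distinct_independent_conj_basis span_conj_basis_rat by (simp add: ordered_basis_def)
  show "matrix_wrt (rat_scale (*s)) (conj_basis \<theta>) (unit_map \<theta>) = map_mat of_int unit_mat"
  proof (rule matrix_wrt_eqI [OF vector_space_rat_vec])
    show "distinct (conj_basis \<theta>)"
      using distinct_independent_conj_basis by simp
    show "map_mat rat_of_int unit_mat \<in> carrier_mat (length (conj_basis \<theta>)) (length (conj_basis \<theta>))"
      by (simp add: length_conj_basis unit_mat_def)
    show "unit_map \<theta> (conj_basis \<theta> ! j) =
        (\<Sum>i<length (conj_basis \<theta>).
          rat_scale (*s) (map_mat rat_of_int unit_mat $$ (i, j)) (conj_basis \<theta> ! i))"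
      if "j < length (conj_basis \<theta>)" for j
      using that by (simp add: length_conj_basis unit_map_conj_basis unit_mat_dim)
  qed (fact indep)
qed (fact invertible_unit_mat)

lemma anosov_U23: "anosov (*s) (U23_bracket (of_rat r)) UNIV"
  unfolding anosov_def rational_anosov_def
  using lie_algebra_U23 rational_form_conj_form lie_algebra_conj_form lie_automorphism_unit_map
    hyperbolic_unit_map unimodular_unit_map
  by blast

end

section \<open>Existence of a root of the cubic\<close>

lemma cubic_unit_exists: "\<exists>\<theta>. cubic_unit \<theta>"
proof -
  \<comment> \<open>The triple-angle formula gives \<open>cos (2 * pi / 3) = -1/2\<close>; doubling
    the cosine clears the leading coefficient 4.\<close>
  have "4 * cos (2 * pi / 9) ^ 3 - 3 * cos (2 * pi / 9) = - 1 / 2"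
    using cos_treble_cos [of "2 * pi / 9"] cos_120 by simp
  then have "(2 * cos (2 * pi / 9)) ^ 3 = 3 * (2 * cos (2 * pi / 9)) - 1"
    by (simp add: power_mult_distrib)
  from arg_cong [OF this, of complex_of_real]
  have "cubic_unit (complex_of_real (2 * cos (2 * pi / 9)))"
    by unfold_locales (simp only: of_real_power of_real_diff of_real_mult of_real_numeral of_real_1)
  then show ?thesis ..
qed

theorem proposition3p7:
  fixes s :: complex
  assumes "s \<in> \<rat>"
  shows "anosov ((*s) :: complex \<Rightarrow> complex ^ basis_index \<Rightarrow> complex ^ basis_index)
           (U23_bracket s) UNIV"
  using assms cubic_unit_exists cubic_unit.anosov_U23 by (auto elim!: Rats_cases)

end
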